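(* Let $C$ be a minimum edge cut of a connected graph $G$, let $G_1$ and $G_2$ be the components of $G\setminus C$, and let $q$ be a real number. If $\gamma_g(G_2) \leq q\cdot n(G_2)$ and $$\gamma_g(G_1) \le \frac{n(G_1)}{2} - \frac{(2q-1)\,n(G_2)}{2} - 2\kappa'(G) - 2,$$ then $\gamma_g(G) \le \lceil n(G)/2\rceil$.
   Context: Graphs are finite and simple; $n(G)$ denotes the order (number of vertices) of $G$. A vertex $x$ dominates every vertex of its closed neighborhood $N[x]$ ($x$ together with its neighbors). The domination game on a graph $G$ is played by Dominator and Staller, who take turns choosing a vertex of $G$ such that at least one previously undominated vertex becomes dominated. The game is over when all vertices of $G$ are dominated. Dominator wants to minimize the number of vertices played, Staller wants to maximize it. In the D-game Dominator has the first move, and $\gamma_g(G)$ (the game domination number) is the number of moves played in the D-game when both players play optimally. An edge cut of a connected graph $G$ is a set $C$ of edges such that $G\setminus C$ is disconnected, where $G\setminus C$ denotes the graph obtained from $G$ by deleting the edges in $C$ (keeping all vertices). A minimum edge cut is an edge cut of smallest cardinality, and this cardinality is the edge-connectivity $\kappa'(G)$; if $C$ is a minimum edge cut of a connected graph, then $G\setminus C$ has exactly two components. *)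

theory Defs
  imports Complex_Main
begin

record 'a ugraph =
  verts :: "'a set"
  edges :: "'a set set"

definition simple_graph :: "'a ugraph \<Rightarrow> bool" where
  "simple_graph G \<longleftrightarrow>
     finite (verts G) \<and> (\<forall>e\<in>edges G. e \<subseteq> verts G \<and> card e = 2)"

definition graph_order :: "'a ugraph \<Rightarrow> nat" where
  "graph_order G = card (verts G)"

definition adj_rel :: "'a ugraph \<Rightarrow> ('a \<times> 'a) set" where
  "adj_rel G = {(x, y). {x, y} \<in> edges G}"

(* The null graph (no vertices) does not count as connected. *)
definition graph_connected :: "'a ugraph \<Rightarrow> bool" where
  "graph_connected G \<longleftrightarrow>
     verts G \<noteq> {} \<and> (\<forall>x\<in>verts G. \<forall>y\<in>verts G. (x, y) \<in> (adj_rel G)\<^sup>*)"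

definition induced_subgraph :: "'a ugraph \<Rightarrow> 'a set \<Rightarrow> 'a ugraph" where
  "induced_subgraph G S = \<lparr>verts = S, edges = {e \<in> edges G. e \<subseteq> S}\<rparr>"

definition graph_components :: "'a ugraph \<Rightarrow> 'a ugraph set" where
  "graph_components G =
     (\<lambda>x. induced_subgraph G {y \<in> verts G. (x, y) \<in> (adj_rel G)\<^sup>*}) ` verts G"

definition delete_edges :: "'a ugraph \<Rightarrow> 'a set set \<Rightarrow> 'a ugraph" where
  "delete_edges G C = \<lparr>verts = verts G, edges = edges G - C\<rparr>"

definition edge_cut :: "'a ugraph \<Rightarrow> 'a set set \<Rightarrow> bool" where
  "edge_cut G C \<longleftrightarrow> C \<subseteq> edges G \<and> \<not> graph_connected (delete_edges G C)"

definition min_edge_cut :: "'a ugraph \<Rightarrow> 'a set set \<Rightarrow> bool" where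
  "min_edge_cut G C \<longleftrightarrow> edge_cut G C \<and> (\<forall>C'. edge_cut G C' \<longrightarrow> card C \<le> card C')"

(* Meaningful only if an edge cut exists, i.e. not for the one-vertex graph. *)
definition edge_connectivity :: "'a ugraph \<Rightarrow> nat" where
  "edge_connectivity G = (LEAST k. \<exists>C. edge_cut G C \<and> card C = k)"

definition closed_nbhd :: "'a ugraph \<Rightarrow> 'a \<Rightarrow> 'a set" where
  "closed_nbhd G x = {y \<in> verts G. y = x \<or> {x, y} \<in> edges G}"

(* D is the set of vertices that are already dominated. *)
definition legal_moves :: "'a ugraph \<Rightarrow> 'a set \<Rightarrow> 'a set" where
  "legal_moves G D = {x \<in> verts G. \<not> closed_nbhd G x \<subseteq> D}"

datatype player = Dominator | Staller

(* The number of moves still to be played under optimal play (the minimax value) when the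
   given player is to move and D is the set of dominated vertices. The finiteness test only
   serves to make the recursion total; under it the sets below Min and Max are finite, and
   they are nonempty because an undominated vertex is itself a legal move. *)
function remaining_moves :: "'a ugraph \<Rightarrow> player \<Rightarrow> 'a set \<Rightarrow> nat" where
  "remaining_moves G p D =
     (if infinite (verts G) \<or> verts G \<subseteq> D then 0
      else case p of
        Dominator \<Rightarrow>
          1 + Min ((\<lambda>x. remaining_moves G Staller (D \<union> closed_nbhd G x)) ` legal_moves G D)
      | Staller \<Rightarrow>
          1 + Max ((\<lambda>x. remaining_moves G Dominator (D \<union> closed_nbhd G x)) ` legal_moves G D))"
  by pat_completeness auto
termination
proof (relation "measure (\<lambda>(G, p, D). card (verts G - D))")
  have less: "card (verts G - (D \<union> closed_nbhd G x)) < card (verts G - D)"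
    if "finite (verts G)" "x \<in> legal_moves G D" for G :: "'a ugraph" and D x
    using that by (intro psubset_card_mono) (auto simp: legal_moves_def closed_nbhd_def)
  show "((G, Staller, D \<union> closed_nbhd G x), G, p, D)
      \<in> measure (\<lambda>(G, p, D). card (verts G - D))"
    if "\<not> (infinite (verts G) \<or> verts G \<subseteq> D)" "x \<in> legal_moves G D"
    for G :: "'a ugraph" and p D x
    using that less by simp
  show "((G, Dominator, D \<union> closed_nbhd G x), G, p, D)
      \<in> measure (\<lambda>(G, p, D). card (verts G - D))"
    if "\<not> (infinite (verts G) \<or> verts G \<subseteq> D)" "x \<in> legal_moves G D"
    for G :: "'a ugraph" and p D x
    using that less by simp
qed simp

declare remaining_moves.simps [simp del]

definition game_domination_number :: "'a ugraph \<Rightarrow> nat" where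
  "game_domination_number G = remaining_moves G Dominator {}"

end

theory Submission
  imports Defs
begin

text \<open>
  Deleting one edge lowers the value of the game by at most 2: Dominator follows an optimal strategy
  of the smaller graph, and the extra edge only matters once, because as soon as one of its
  endpoints is played both are dominated and the two games coincide. Iterating over \<open>C\<close> costs
  \<open>2 |C|\<close>. In the disjoint union \<open>G - C\<close> Dominator always answers in the component in which
  Staller has just moved. Passing from the D-game to the S-game on the second component costs one
  move, and one more is lost when Staller finishes a component and Dominator has to open the other
  one. Altogether \<open>\<gamma>\<^sub>g(G) \<le> \<gamma>\<^sub>g(G\<^sub>1) + \<gamma>\<^sub>g(G\<^sub>2) + 2 |C| + 2\<close>.
\<close>

section \<open>Optimal moves\<close>

lemma closed_nbhd_subset: "closed_nbhd G x \<subseteq> verts G"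
  by (auto simp: closed_nbhd_def)

text \<open>In a simple graph a vertex outside \<open>verts G\<close> has an empty closed
  neighborhood, so legality can be read off from the set \<open>closed_nbhd G x - D\<close> alone.
  This lets \<open>remaining_moves_cong\<close> compare graphs with different vertex sets.\<close>

lemma legal_moves_iff:
  assumes "simple_graph G"
  shows "x \<in> legal_moves G D \<longleftrightarrow> closed_nbhd G x - D \<noteq> {}"
  using assms by (auto simp: legal_moves_def closed_nbhd_def simple_graph_def)

lemma legal_moves_nonempty: "\<not> verts G \<subseteq> D \<Longrightarrow> legal_moves G D \<noteq> {}"
  by (auto simp: legal_moves_def closed_nbhd_def)

lemma finite_legal_moves: "finite (verts G) \<Longrightarrow> finite (legal_moves G D)"
  by (simp add: legal_moves_def)

lemma legal_moves_not_over: "x \<in> legal_moves G D \<Longrightarrow> \<not> verts G \<subseteq> D"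
  by (auto simp: legal_moves_def closed_nbhd_def)

lemma legal_move_progress:
  "x \<in> legal_moves G D \<Longrightarrow> verts G - (D \<union> closed_nbhd G x) \<subset> verts G - D"
  by (auto simp: legal_moves_def closed_nbhd_def)

text \<open>Induction on the number of undominated vertices. The premise asks for a strict inclusion
  of the undominated sets, which is what \<open>legal_move_progress\<close> supplies after each
  move.\<close>

lemma domination_induct [consumes 1]:
  assumes "finite V" and "\<And>D. (\<And>D'. V - D' \<subset> V - D \<Longrightarrow> P D') \<Longrightarrow> P D"
  shows "P D"
proof (induction "card (V - D)" arbitrary: D rule: less_induct)
  case less
  show ?case
    by (rule assms(2)) (use less assms(1) in \<open>auto intro: psubset_card_mono\<close>)
qed

lemma remaining_moves_over [simp]: "verts G \<subseteq> D \<Longrightarrow> remaining_moves G p D = 0"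
  by (simp add: remaining_moves.simps)

text \<open>With the next three lemmas this turns the minimax recursion into rules for comparing
  strategies: any legal move bounds the value from one side, and some legal move attains it.\<close>

lemma remaining_moves_Dominator_le:
  assumes "finite (verts G)" "x \<in> legal_moves G D"
  shows "remaining_moves G Dominator D \<le> Suc (remaining_moves G Staller (D \<union> closed_nbhd G x))"
  using assms legal_moves_not_over[OF assms(2)]
  by (subst remaining_moves.simps) (auto simp: finite_legal_moves intro!: Min_le)

lemma remaining_moves_Staller_ge:
  assumes "finite (verts G)" "x \<in> legal_moves G D"
  shows "Suc (remaining_moves G Dominator (D \<union> closed_nbhd G x)) \<le> remaining_moves G Staller D"
  using assms legal_moves_not_over[OF assms(2)]
  by (subst remaining_moves.simps[of G Staller D]) (auto simp: finite_legal_moves intro!: Max_ge)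

lemma Dominator_optimal_move:
  assumes "finite (verts G)" "\<not> verts G \<subseteq> D"
  obtains x where "x \<in> legal_moves G D"
    "remaining_moves G Dominator D = Suc (remaining_moves G Staller (D \<union> closed_nbhd G x))"
proof -
  let ?M = "(\<lambda>x. remaining_moves G Staller (D \<union> closed_nbhd G x)) ` legal_moves G D"
  have "Min ?M \<in> ?M" using assms(1) by (intro Min_in) (auto simp: finite_legal_moves legal_moves_nonempty[OF assms(2)])
  then obtain x where x: "Min ?M = remaining_moves G Staller (D \<union> closed_nbhd G x)"
    "x \<in> legal_moves G D"
    by (rule imageE)
  have "remaining_moves G Dominator D = Suc (Min ?M)"
    unfolding remaining_moves.simps[of G Dominator D] using assms by simp
  then show ?thesis unfolding x(1) by (rule that[OF x(2)])
qed

lemma Staller_optimal_move: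
  assumes "finite (verts G)" "\<not> verts G \<subseteq> D"
  obtains x where "x \<in> legal_moves G D"
    "remaining_moves G Staller D = Suc (remaining_moves G Dominator (D \<union> closed_nbhd G x))"
proof -
  let ?M = "(\<lambda>x. remaining_moves G Dominator (D \<union> closed_nbhd G x)) ` legal_moves G D"
  have "Max ?M \<in> ?M" using assms(1) by (intro Max_in) (auto simp: finite_legal_moves legal_moves_nonempty[OF assms(2)])
  then obtain x where x: "Max ?M = remaining_moves G Dominator (D \<union> closed_nbhd G x)"
    "x \<in> legal_moves G D"
    by (rule imageE)
  have "remaining_moves G Staller D = Suc (Max ?M)"
    unfolding remaining_moves.simps[of G Staller D] using assms by simp
  then show ?thesis unfolding x(1) by (rule that[OF x(2)])
qed

section \<open>The continuation principle\<close>

text \<open>Imagination strategy: Dominator, playing from \<open>D'\<close>, pictures a game from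
  \<open>D\<close> and copies his optimal moves there, while every move of Staller from
  \<open>D'\<close> is also legal from \<open>D\<close>. The inclusion of the dominated sets
  survives each move.\<close>

lemma remaining_moves_antimono:
  assumes fin: "finite (verts G)" and "D \<inter> verts G \<subseteq> D'"
  shows "remaining_moves G p D' \<le> remaining_moves G p D"
  using assms
proof (induction D' arbitrary: p D rule: domination_induct)
  case (1 D')
  show ?case
  proof (cases "verts G \<subseteq> D'")
    case False
    then have over: "\<not> verts G \<subseteq> D" using 1(2) by blast
    show ?thesis
    proof (cases p)
      case Dominator
      obtain x where x: "x \<in> legal_moves G D"
        "remaining_moves G Dominator D = Suc (remaining_moves G Staller (D \<union> closed_nbhd G x))"
        using Dominator_optimal_move[OF fin over] by blast
      \<comment> \<open>If the imagined move \<open>x\<close> is no longer legal, its whole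
        neighborhood is already dominated, so an arbitrary legal \<open>y\<close> preserves the
        inclusion.\<close>
      obtain y where y: "y \<in> legal_moves G D'" "closed_nbhd G x \<subseteq> D' \<union> closed_nbhd G y"
      proof (cases "x \<in> legal_moves G D'")
        case True
        then show ?thesis using that by blast
      next
        case nlegal: False
        then have "closed_nbhd G x \<subseteq> D'" using x(1) by (auto simp: legal_moves_def)
        moreover obtain z where "z \<in> legal_moves G D'" using legal_moves_nonempty[OF False] by blast
        ultimately show ?thesis using that by blast
      qed
      have "remaining_moves G Staller (D' \<union> closed_nbhd G y)
              \<le> remaining_moves G Staller (D \<union> closed_nbhd G x)"
        using 1(2) y by (intro 1(1) legal_move_progress fin) auto
      then show ?thesis
        using remaining_moves_Dominator_le[OF fin y(1)] x(2) Dominator by simp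
    next
      case Staller
      obtain x where x: "x \<in> legal_moves G D'"
        "remaining_moves G Staller D' = Suc (remaining_moves G Dominator (D' \<union> closed_nbhd G x))"
        using Staller_optimal_move[OF fin False] by blast
      have legal: "x \<in> legal_moves G D"
        using x(1) 1(2) closed_nbhd_subset[of G x] by (auto simp: legal_moves_def)
      have "remaining_moves G Dominator (D' \<union> closed_nbhd G x)
              \<le> remaining_moves G Dominator (D \<union> closed_nbhd G x)"
        using 1(2) x(1) by (intro 1(1) legal_move_progress fin) auto
      then show ?thesis
        using remaining_moves_Staller_ge[OF fin legal] x(2) Staller by simp
    qed
  qed simp
qed

text \<open>The first move is counted as one, and by the continuation principle the vertices it
  dominates cannot lengthen what follows. The converse comparison below is proved in the same
  way.\<close>

lemma remaining_moves_Staller_le_Dominator: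
  assumes fin: "finite (verts G)"
  shows "remaining_moves G Staller D \<le> Suc (remaining_moves G Dominator D)"
proof (cases "verts G \<subseteq> D")
  case False
  then obtain x where
    "remaining_moves G Staller D = Suc (remaining_moves G Dominator (D \<union> closed_nbhd G x))"
    using Staller_optimal_move[OF fin] by blast
  then show ?thesis using remaining_moves_antimono[OF fin, of D "D \<union> closed_nbhd G x"] by auto
qed simp

lemma remaining_moves_Dominator_le_Staller:
  assumes fin: "finite (verts G)"
  shows "remaining_moves G Dominator D \<le> Suc (remaining_moves G Staller D)"
proof (cases "verts G \<subseteq> D")
  case False
  then obtain x where
    "remaining_moves G Dominator D = Suc (remaining_moves G Staller (D \<union> closed_nbhd G x))"
    using Dominator_optimal_move[OF fin] by blast
  then show ?thesis using remaining_moves_antimono[OF fin, of D "D \<union> closed_nbhd G x"] by auto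
qed simp

text \<open>Both the legality of a move and its effect depend only on the undominated part of the
  closed neighborhood. Hence edges between dominated vertices, and dominated vertices without
  undominated neighbors, may differ between the two graphs.\<close>

lemma remaining_moves_cong:
  assumes G: "simple_graph G" and H: "simple_graph H"
    and "\<And>x. closed_nbhd G x - D = closed_nbhd H x - D"
  shows "remaining_moves G p D = remaining_moves H p D"
proof -
  have "finite (verts G)" using G by (simp add: simple_graph_def)
  then show ?thesis using assms(3)
  proof (induction D arbitrary: p rule: domination_induct)
    case (1 D)
    have legal: "legal_moves G D = legal_moves H D"
      by (rule set_eqI) (simp only: legal_moves_iff[OF G] legal_moves_iff[OF H] 1(2))
    \<comment> \<open>The vertex sets are not assumed equal. Their undominated parts are recovered
      from the neighborhoods, so both games end at the same time.\<close>
    have "v \<in> verts K - D \<longleftrightarrow> v \<in> closed_nbhd K v - D" for v and K :: "'a ugraph"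
      by (auto simp: closed_nbhd_def)
    then have over: "verts G \<subseteq> D \<longleftrightarrow> verts H \<subseteq> D" using 1(2) by blast
    have nbhd: "D \<union> closed_nbhd G x = D \<union> closed_nbhd H x" for x using 1(2) by blast
    have "remaining_moves G p' (D \<union> closed_nbhd H x) = remaining_moves H p' (D \<union> closed_nbhd H x)"
      if "x \<in> legal_moves H D" for p' x
    proof (rule 1(1))
      have "x \<in> legal_moves G D" using that legal by simp
      then show "verts G - (D \<union> closed_nbhd H x) \<subset> verts G - D"
        using legal_move_progress[of x G D] nbhd by simp
      show "closed_nbhd G y - (D \<union> closed_nbhd H x) = closed_nbhd H y - (D \<union> closed_nbhd H x)" for y
        using 1(2)[of y] by blast
    qed
    then have moves: "(\<lambda>x. remaining_moves G p' (D \<union> closed_nbhd G x)) ` legal_moves G D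
      = (\<lambda>x. remaining_moves H p' (D \<union> closed_nbhd H x)) ` legal_moves H D" for p'
      using legal nbhd by (intro image_cong) auto
    have "finite (verts G)" "finite (verts H)"
      using G H by (auto simp: simple_graph_def)
    then show ?case
      unfolding remaining_moves.simps[of G p D] remaining_moves.simps[of H p D]
      by (simp only: over moves simp_thms)
  qed
qed

section \<open>Deleting edges\<close>

lemma simple_graph_delete_edges: "simple_graph G \<Longrightarrow> simple_graph (delete_edges G C)"
  by (simp add: simple_graph_def delete_edges_def)

lemma verts_delete_edges [simp]: "verts (delete_edges G C) = verts G"
  by (simp add: delete_edges_def)

lemma closed_nbhd_delete_edges_subset: "closed_nbhd (delete_edges G C) x \<subseteq> closed_nbhd G x"
  by (auto simp: closed_nbhd_def delete_edges_def)

text \<open>Dominator follows the game on \<open>H\<close>, the graph without \<open>e\<close>.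
  Neighborhoods in \<open>G\<close> are at least as large, so his moves stay legal, and Staller's
  moves off \<open>e\<close> are the same in both games. A loss can occur only when Staller plays an
  endpoint of \<open>e\<close>, after which the two games agree for good.\<close>

lemma remaining_moves_delete_edge:
  assumes G: "simple_graph G"
  shows "remaining_moves G p D \<le> remaining_moves (delete_edges G {e}) p D + 2"
proof (cases "e \<in> edges G")
  case False
  then have "delete_edges G {e} = G" by (simp add: delete_edges_def)
  then show ?thesis by simp
next
  case e: True
  define H where "H = delete_edges G {e}"
  have fin: "finite (verts G)" using G by (simp add: simple_graph_def)
  have verts: "verts H = verts G" by (simp add: H_def)
  then have finH: "finite (verts H)" using fin by simp
  have H: "simple_graph H" unfolding H_def by (rule simple_graph_delete_edges[OF G])
  have sub: "closed_nbhd H x \<subseteq> closed_nbhd G x" for x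
    unfolding H_def by (rule closed_nbhd_delete_edges_subset)
  from fin have "remaining_moves G p D \<le> remaining_moves H p D + 2"
  proof (induction D arbitrary: p rule: domination_induct)
    case (1 D)
    show ?case
    proof (cases "verts G \<subseteq> D")
      case False
      then have overH: "\<not> verts H \<subseteq> D" by (simp add: verts)
      show ?thesis
      proof (cases p)
        case Dominator
        obtain x where x: "x \<in> legal_moves H D"
          "remaining_moves H Dominator D = Suc (remaining_moves H Staller (D \<union> closed_nbhd H x))"
          using Dominator_optimal_move[OF finH overH] by blast
        then have legal: "x \<in> legal_moves G D"
          using sub by (auto simp: legal_moves_def verts)
        \<comment> \<open>The additional vertex that \<open>x\<close> may dominate in
          \<open>G\<close> is forgotten, so that both games continue from the same dominated
          set.\<close>
        have "remaining_moves G Staller (D \<union> closed_nbhd G x)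
                \<le> remaining_moves G Staller (D \<union> closed_nbhd H x)"
          using sub by (intro remaining_moves_antimono[OF fin]) blast
        also have "\<dots> \<le> remaining_moves H Staller (D \<union> closed_nbhd H x) + 2"
          using legal_move_progress[OF x(1)] by (intro 1(1)) (simp add: verts)
        finally show ?thesis
          using remaining_moves_Dominator_le[OF fin legal] x(2) Dominator by simp
      next
        case Staller
        obtain x where x: "x \<in> legal_moves G D"
          "remaining_moves G Staller D = Suc (remaining_moves G Dominator (D \<union> closed_nbhd G x))"
          using Staller_optimal_move[OF fin False] by blast
        show ?thesis
        proof (cases "x \<in> e")
          case True
          let ?D = "D \<union> closed_nbhd G x"
          have "e \<subseteq> verts G" "card e = 2" using G e by (auto simp: simple_graph_def)
          then obtain w where w: "e = {x, w}"
            using True by (auto simp: card_2_iff insert_commute)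
          then have "e \<subseteq> closed_nbhd G x"
            using \<open>e \<subseteq> verts G\<close> e by (simp add: closed_nbhd_def)
          \<comment> \<open>The neighborhoods in \<open>G\<close> and \<open>H\<close> differ at
            most in endpoints of \<open>e\<close>, and both endpoints are dominated once
            \<open>x\<close> is played in \<open>G\<close>.\<close>
          moreover have "closed_nbhd G y - e = closed_nbhd H y - e" for y
            unfolding closed_nbhd_def H_def delete_edges_def by auto
          ultimately have "closed_nbhd G y - ?D = closed_nbhd H y - ?D" for y
            by blast
          then have eq: "remaining_moves G Dominator ?D = remaining_moves H Dominator ?D"
            by (rule remaining_moves_cong[OF G H])
          show ?thesis
          proof (cases "x \<in> legal_moves H D")
            case True
            have "remaining_moves H Dominator ?D
                    \<le> remaining_moves H Dominator (D \<union> closed_nbhd H x)"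
              using sub by (intro remaining_moves_antimono[OF finH]) blast
            then show ?thesis
              using remaining_moves_Staller_ge[OF finH True] eq x(2) Staller by simp
          next
            \<comment> \<open>Here the loss of 2 arises: \<open>x\<close> gains a new vertex only
              through \<open>e\<close>, so Staller's move has no counterpart in \<open>H\<close>. It
              costs one move, and giving the turn in \<open>H\<close> to Dominator costs
              another.\<close>
            case False
            have "remaining_moves H Dominator ?D \<le> remaining_moves H Dominator D"
              by (intro remaining_moves_antimono[OF finH]) blast
            then show ?thesis
              using remaining_moves_Dominator_le_Staller[OF finH, of D] eq x(2) Staller by simp
          qed
        next
          case False
          then have nbhd: "closed_nbhd H x = closed_nbhd G x"
            by (auto simp: closed_nbhd_def H_def delete_edges_def)
          then have legal: "x \<in> legal_moves H D"
            using x(1) by (simp add: legal_moves_def verts)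
          have "remaining_moves G Dominator (D \<union> closed_nbhd G x)
                  \<le> remaining_moves H Dominator (D \<union> closed_nbhd G x) + 2"
            by (intro 1(1) legal_move_progress x)
          then show ?thesis
            using remaining_moves_Staller_ge[OF finH legal] nbhd x(2) Staller by simp
        qed
      qed
    qed simp
  qed
  then show ?thesis by (simp add: H_def)
qed

lemma remaining_moves_delete_edges:
  assumes "finite C" "simple_graph G"
  shows "remaining_moves G p D \<le> remaining_moves (delete_edges G C) p D + 2 * card C"
  using assms
proof (induction C)
  case empty
  have "delete_edges G {} = G" by (simp add: delete_edges_def)
  then show ?case by simp
next
  case (insert e C)
  have "remaining_moves G p D \<le> remaining_moves (delete_edges G C) p D + 2 * card C"
    using insert by blast
  also have "remaining_moves (delete_edges G C) p D
      \<le> remaining_moves (delete_edges (delete_edges G C) {e}) p D + 2"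
    by (intro remaining_moves_delete_edge simple_graph_delete_edges insert)
  also have "delete_edges (delete_edges G C) {e} = delete_edges G (insert e C)"
    unfolding delete_edges_def by auto
  finally show ?case using insert.hyps by simp
qed

section \<open>Disjoint unions\<close>

text \<open>In a simple graph these are the unions of components, including the empty one. The
  notion passes to complements, so the two sides of a disjoint union can be interchanged.\<close>

definition separated :: "'a ugraph \<Rightarrow> 'a set \<Rightarrow> bool" where
  "separated G S \<longleftrightarrow> S \<subseteq> verts G \<and> (\<forall>e\<in>edges G. e \<subseteq> S \<or> e \<inter> S = {})"

lemma separated_compl:
  "simple_graph G \<Longrightarrow> separated G S \<Longrightarrow> separated G (verts G - S)"
  unfolding separated_def simple_graph_def by blast

lemma verts_induced_subgraph [simp]: "verts (induced_subgraph G S) = S"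
  by (simp add: induced_subgraph_def)

lemma simple_graph_induced_subgraph:
  "simple_graph G \<Longrightarrow> S \<subseteq> verts G \<Longrightarrow> simple_graph (induced_subgraph G S)"
  by (auto simp: simple_graph_def induced_subgraph_def intro: finite_subset)

lemma closed_nbhd_induced_subgraph:
  assumes "separated G S" "x \<in> S"
  shows "closed_nbhd (induced_subgraph G S) x = closed_nbhd G x"
  using assms unfolding closed_nbhd_def induced_subgraph_def separated_def by auto

text \<open>A vertex outside \<open>S\<close> reaches only vertices outside \<open>S\<close>, all of
  them dominated, so it is never a legal move. Inside \<open>S\<close> the neighborhoods are
  unchanged.\<close>

lemma remaining_moves_induced_subgraph:
  assumes G: "simple_graph G" and S: "separated G S" and D: "verts G - S \<subseteq> D"
  shows "remaining_moves G p D = remaining_moves (induced_subgraph G S) p D"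
proof (rule remaining_moves_cong[OF G])
  have "S \<subseteq> verts G" using S by (simp add: separated_def)
  then show "simple_graph (induced_subgraph G S)" by (rule simple_graph_induced_subgraph[OF G])
  show "closed_nbhd G x - D = closed_nbhd (induced_subgraph G S) x - D" for x
  proof (cases "x \<in> S")
    case True
    then show ?thesis using closed_nbhd_induced_subgraph[OF S] by simp
  next
    case False
    then have "closed_nbhd G x \<inter> S = {}"
      using S by (auto simp: closed_nbhd_def separated_def)
    moreover have "closed_nbhd (induced_subgraph G S) x = {}"
      using False by (auto simp: closed_nbhd_def induced_subgraph_def)
    ultimately show ?thesis using D closed_nbhd_subset[of G x] by blast
  qed
qed

text \<open>Dominator replies optimally on the side where Staller has just moved, so each side is
  played as a game started by Staller. The extra 1 is spent when Staller finishes one side and no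
  reply is available there; afterwards only one side remains.\<close>

lemma remaining_moves_Staller_union:
  assumes G: "simple_graph G" and "separated G S"
  shows "remaining_moves G Staller D \<le> remaining_moves (induced_subgraph G S) Staller D
           + remaining_moves (induced_subgraph G (verts G - S)) Staller D + 1"
proof -
  have fin: "finite (verts G)" using G by (simp add: simple_graph_def)
  then show ?thesis using assms(2)
  proof (induction D arbitrary: S rule: domination_induct)
    case (1 D)
    show ?case
    proof (cases "verts G \<subseteq> D")
      case False
      obtain x where x: "x \<in> legal_moves G D"
        "remaining_moves G Staller D = Suc (remaining_moves G Dominator (D \<union> closed_nbhd G x))"
        using Staller_optimal_move[OF fin False] by blast
      let ?D = "D \<union> closed_nbhd G x"
      \<comment> \<open>\<open>T\<close> denotes the side containing Staller's move
        \<open>x\<close>. It may be the complement of \<open>S\<close>, which is why the induction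
        leaves \<open>S\<close> arbitrary.\<close>
      have key: ?thesis if T: "separated G T" and xT: "x \<in> T" and TS: "T = S \<or> T = verts G - S" for T
      proof -
        let ?A = "induced_subgraph G T" and ?B = "induced_subgraph G (verts G - T)"
        have TV: "T \<subseteq> verts G" using T by (simp add: separated_def)
        then have finA: "finite (verts ?A)" and finB: "finite (verts ?B)"
          using fin by (auto intro: finite_subset)
        have nbhd: "closed_nbhd ?A y = closed_nbhd G y" if "y \<in> T" for y
          using closed_nbhd_induced_subgraph[OF T that] .
        have legalA: "x \<in> legal_moves ?A D"
          using x(1) xT nbhd by (simp add: legal_moves_def)
        have A: "Suc (remaining_moves ?A Dominator ?D) \<le> remaining_moves ?A Staller D"
          using remaining_moves_Staller_ge[OF finA legalA] nbhd[OF xT] by simp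
        have B: "remaining_moves ?B Staller E \<le> remaining_moves ?B Staller D" if "D \<subseteq> E" for E
          using that by (intro remaining_moves_antimono[OF finB]) blast
        have "remaining_moves G Staller D
                \<le> remaining_moves ?A Staller D + remaining_moves ?B Staller D + 1"
        proof (cases "T \<subseteq> ?D")
          \<comment> \<open>Staller has completed \<open>T\<close>. The game goes on in
            \<open>?B\<close> with Dominator to move, and comparing this with Staller moving first
            uses up the 1.\<close>
          case True
          have T': "separated G (verts G - T)" by (rule separated_compl[OF G T])
          have "remaining_moves G Dominator ?D = remaining_moves ?B Dominator ?D"
            using True by (intro remaining_moves_induced_subgraph[OF G T']) blast
          also have "\<dots> \<le> Suc (remaining_moves ?B Staller ?D)"
            by (rule remaining_moves_Dominator_le_Staller[OF finB])
          also have "\<dots> \<le> Suc (remaining_moves ?B Staller D)" using B[of ?D] by simp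
          finally show ?thesis using x(2) A by simp
        next
          case False
          then obtain y where y: "y \<in> legal_moves ?A ?D" "remaining_moves ?A Dominator ?D
              = Suc (remaining_moves ?A Staller (?D \<union> closed_nbhd ?A y))"
            using Dominator_optimal_move[OF finA, of ?D] by auto
          then have yT: "y \<in> T" by (simp add: legal_moves_def)
          then have legal: "y \<in> legal_moves G ?D"
            using y(1) nbhd TV by (auto simp: legal_moves_def)
          let ?E = "?D \<union> closed_nbhd G y"
          \<comment> \<open>The pair \<open>x\<close>, \<open>y\<close> accounts for two moves in
            \<open>?A\<close> and leaves Staller to move again, so the induction hypothesis still
            carries the single extra 1.\<close>
          have "verts G - ?E \<subset> verts G - D"
            using legal_move_progress[OF x(1)] legal_move_progress[OF legal] by blast
          then have "remaining_moves G Staller ?E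
              \<le> remaining_moves ?A Staller ?E + remaining_moves ?B Staller ?E + 1"
            using T by (rule 1(1))
          then show ?thesis
            using remaining_moves_Dominator_le[OF fin legal] B[of ?E, OF le_supI1[OF Un_upper1]]
              x(2) y(2) nbhd[OF yT] A by simp
        qed
        moreover have "verts G - (verts G - S) = S"
          using 1(2) by (auto simp: separated_def)
        ultimately show ?thesis using TS by auto
      qed
      have "x \<in> verts G" using x(1) by (simp add: legal_moves_def)
      then show ?thesis
        using key[OF 1(2)] key[OF separated_compl[OF G 1(2)]] by blast
    qed simp
  qed
qed

text \<open>Dominator opens with an optimal move in \<open>S\<close>, which is possible as
  \<open>S\<close> is nonempty; then Staller is to move on both sides. One of the two extra moves
  comes from \<open>remaining_moves_Staller_union\<close>, the other from replacing the
  Staller-start game on the complement by the D-game.\<close>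

lemma game_domination_number_union:
  assumes G: "simple_graph G" and S: "separated G S" and "S \<noteq> {}"
  shows "game_domination_number G \<le> game_domination_number (induced_subgraph G S)
           + game_domination_number (induced_subgraph G (verts G - S)) + 2"
proof -
  let ?A = "induced_subgraph G S" and ?B = "induced_subgraph G (verts G - S)"
  have fin: "finite (verts G)" using G by (simp add: simple_graph_def)
  have SV: "S \<subseteq> verts G" using S by (simp add: separated_def)
  then have finA: "finite (verts ?A)" and finB: "finite (verts ?B)"
    using fin by (auto intro: finite_subset)
  obtain x where x: "x \<in> legal_moves ?A {}" "remaining_moves ?A Dominator {}
      = Suc (remaining_moves ?A Staller ({} \<union> closed_nbhd ?A x))"
    using Dominator_optimal_move[OF finA, of "{}"] \<open>S \<noteq> {}\<close> by auto
  let ?D = "{} \<union> closed_nbhd G x"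
  have nbhd: "closed_nbhd ?A x = closed_nbhd G x"
    using x(1) by (intro closed_nbhd_induced_subgraph[OF S]) (simp add: legal_moves_def)
  have "x \<in> legal_moves G {}"
    using x(1) SV nbhd by (auto simp: legal_moves_def)
  then have "remaining_moves G Dominator {} \<le> Suc (remaining_moves G Staller ?D)"
    by (rule remaining_moves_Dominator_le[OF fin])
  also have "remaining_moves G Staller ?D
      \<le> remaining_moves ?A Staller ?D + remaining_moves ?B Staller ?D + 1"
    by (rule remaining_moves_Staller_union[OF G S])
  also have "remaining_moves ?B Staller ?D \<le> remaining_moves ?B Staller {}"
    by (rule remaining_moves_antimono[OF finB]) simp
  also have "\<dots> \<le> Suc (remaining_moves ?B Dominator {})"
    by (rule remaining_moves_Staller_le_Dominator[OF finB])
  finally show ?thesis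
    using x(2) nbhd by (simp add: game_domination_number_def)
qed

section \<open>Components after deleting the cut, and the final estimate\<close>

lemma separated_component:
  assumes G: "simple_graph G"
  shows "separated G {y \<in> verts G. (x, y) \<in> (adj_rel G)\<^sup>*}"
  unfolding separated_def
proof (intro conjI ballI)
  fix e assume e: "e \<in> edges G"
  then obtain a b where ab: "e = {a, b}" "a \<in> verts G" "b \<in> verts G"
    using G by (auto simp: simple_graph_def card_2_iff)
  have "(a, b) \<in> adj_rel G" "(b, a) \<in> adj_rel G"
    using e ab(1) by (auto simp: adj_rel_def insert_commute)
  then have "(x, a) \<in> (adj_rel G)\<^sup>* \<longleftrightarrow> (x, b) \<in> (adj_rel G)\<^sup>*"
    by (meson rtrancl.rtrancl_into_rtrancl)
  then show "e \<subseteq> {y \<in> verts G. (x, y) \<in> (adj_rel G)\<^sup>*}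
      \<or> e \<inter> {y \<in> verts G. (x, y) \<in> (adj_rel G)\<^sup>*} = {}"
    using ab by auto
qed auto

text \<open>Components are the classes of an equivalence relation on the vertices. When there are
  exactly two classes, each is the complement of the other.\<close>

lemma two_components:
  assumes G: "simple_graph G" and comps: "graph_components G = {G1, G2}" and "G1 \<noteq> G2"
  obtains S where "separated G S" "S \<noteq> {}"
    "G1 = induced_subgraph G S" "G2 = induced_subgraph G (verts G - S)"
proof -
  let ?S = "\<lambda>x. {y \<in> verts G. (x, y) \<in> (adj_rel G)\<^sup>*}"
  have "sym ((adj_rel G)\<^sup>*)"
    by (intro sym_rtrancl) (auto simp: sym_def adj_rel_def insert_commute)
  then have eq: "?S x = ?S y" if "z \<in> ?S x" "z \<in> ?S y" for x y z
    using that by (auto dest: symD intro: rtrancl_trans)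
  have "G1 \<in> graph_components G" "G2 \<in> graph_components G" using comps by auto
  then obtain a b where a: "a \<in> verts G" "G1 = induced_subgraph G (?S a)"
    and b: "b \<in> verts G" "G2 = induced_subgraph G (?S b)"
    by (auto simp: graph_components_def)
  have disj: "?S a \<inter> ?S b = {}"
  proof (rule ccontr)
    assume "?S a \<inter> ?S b \<noteq> {}"
    then obtain z where "z \<in> ?S a" "z \<in> ?S b" by blast
    then have "?S a = ?S b" by (rule eq)
    then show False using a(2) b(2) \<open>G1 \<noteq> G2\<close> by simp
  qed
  have "verts G - ?S a \<subseteq> ?S b"
  proof
    fix z assume z: "z \<in> verts G - ?S a"
    then have "induced_subgraph G (?S z) \<in> {G1, G2}"
      using comps by (auto simp: graph_components_def)
    \<comment> \<open>Equal components have equal vertex sets, so the class of \<open>z\<close> is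
      one of the two; \<open>z\<close> lies in its own class and not in that of
      \<open>a\<close>.\<close>
    then have "?S z = ?S a \<or> ?S z = ?S b"
      using a(2) b(2) verts_induced_subgraph by (metis (no_types, lifting) insertE singletonD)
    moreover have "z \<in> ?S z" using z by simp
    ultimately show "z \<in> ?S b" using z by blast
  qed
  then have "?S b = verts G - ?S a" using disj by blast
  then show ?thesis
    using that[OF separated_component[OF G, of a]] a b by auto
qed

lemma edge_connectivity_eq_card_min_edge_cut:
  assumes "min_edge_cut G C"
  shows "edge_connectivity G = card C"
  unfolding edge_connectivity_def
  by (rule Least_equality) (use assms in \<open>auto simp: min_edge_cut_def\<close>)

theorem theorem5p1:
  fixes G G1 G2 :: "'a ugraph" and C :: "'a set set" and q :: real
  assumes "simple_graph G"
    and "graph_connected G"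
    and "min_edge_cut G C"
    and "graph_components (delete_edges G C) = {G1, G2}"
    and "G1 \<noteq> G2"
    and "real (game_domination_number G2) \<le> q * real (graph_order G2)"
    and "real (game_domination_number G1)
           \<le> real (graph_order G1) / 2 - (2 * q - 1) * real (graph_order G2) / 2
              - 2 * real (edge_connectivity G) - 2"
  shows "int (game_domination_number G) \<le> \<lceil>real (graph_order G) / 2\<rceil>"
proof -
  let ?H = "delete_edges G C"
  have H: "simple_graph ?H" by (rule simple_graph_delete_edges[OF assms(1)])
  have finV: "finite (verts G)" and "edges G \<subseteq> Pow (verts G)"
    using assms(1) by (auto simp: simple_graph_def)
  \<comment> \<open>Finiteness of the cut makes its cardinality meaningful for the bound of 2 per
    deleted edge.\<close>
  then have "finite C"
    using assms(3) unfolding min_edge_cut_def edge_cut_def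
    by (meson finite_Pow_iff finite_subset)
  then have G: "game_domination_number G \<le> game_domination_number ?H + 2 * edge_connectivity G"
    using remaining_moves_delete_edges[OF _ assms(1)]
      edge_connectivity_eq_card_min_edge_cut[OF assms(3)]
    by (simp add: game_domination_number_def)
  obtain S where S: "separated ?H S" "S \<noteq> {}"
    "G1 = induced_subgraph ?H S" "G2 = induced_subgraph ?H (verts ?H - S)"
    using two_components[OF H assms(4,5)] by blast
  have "game_domination_number ?H \<le> game_domination_number G1 + game_domination_number G2 + 2"
    using game_domination_number_union[OF H S(1,2)] S(3,4) by simp
  with G have "real (game_domination_number G)
      \<le> game_domination_number G1 + game_domination_number G2 + 2 * edge_connectivity G + 2"
    by linarith
  \<comment> \<open>The terms with \<open>q\<close> cancel: adding \<open>q * graph_order G2\<close>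
    to \<open>- (2 * q - 1) * graph_order G2 / 2\<close> leaves \<open>graph_order G2 / 2\<close>.
    The summands \<open>2 * edge_connectivity G\<close> and 2 cancel as well.\<close>
  also have "\<dots> \<le> (graph_order G1 + graph_order G2) / 2"
    using assms(6,7) by (simp add: field_simps)
  also have "graph_order G1 + graph_order G2 = graph_order G"
  proof -
    have "S \<subseteq> verts G" using S(1) by (simp add: separated_def)
    then have "card S + card (verts G - S) = card (verts G)"
      using finV by (simp add: card_Diff_subset card_mono finite_subset)
    then show ?thesis using S(3,4) by (simp add: graph_order_def)
  qed
  finally show ?thesis by linarith
qed

end
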